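(* Let $A$ and $B$ be two perm algebras. There is a one-to-one correspondence $$\Psi:\ H^{2}_{nab}(B,A)\to\mathcal{E}xt(B,A),\qquad[(\triangleright,\triangleleft,\chi)]\mapsto[\mathcal{E}^{(\triangleright,\triangleleft,\chi)}],$$ where $[(\triangleright,\triangleleft,\chi)]$ is the equivalence class of $(\triangleright,\triangleleft,\chi)$. In other words, $H^{2}_{nab}(B,A)$ classifies non-abelian extensions of $B$ by $A$.
   Context: All vector spaces are over a field $\mathbb{K}$ of characteristic zero. A perm algebra is a vector space $A$ with a bilinear product satisfying $(a_1a_2)a_3=a_1(a_2a_3)=a_1(a_3a_2)$ for all $a_1,a_2,a_3\in A$ (no unit is required). A non-abelian extension $\mathcal{E}$ of $B$ by $A$ is a short exact sequence of perm algebras $0\to A\xrightarrow{\iota}E\xrightarrow{\pi}B\to0$. Two extensions $\mathcal{E},\mathcal{E}'$ of $B$ by $A$ (with middle terms $E,E'$ and maps $\iota,\pi$ and $\iota',\pi'$) are equivalent if there is a morphism of perm algebras $\varphi:E\to E'$ with $\varphi\circ\iota=\iota'$ and $\pi'\circ\varphi=\pi$. $\mathcal{E}xt(B,A)$ is the set of all equivalence classes $[\mathcal{E}]$ of non-abelian extensions of $B$ by $A$. A non-abelian 2-cocycle on $B$ with values in $A$ is a triple $(\triangleright,\triangleleft,\chi)$ of bilinear maps $\triangleright:B\times A\to A$, $\triangleleft:A\times B\to A$, $\chi:B\times B\to A$ such that for all $a,a_1,a_2\in A$ and $b,b_1,b_2,b_3\in B$: (1) $(a_1a_2)\triangleleft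 b-(a_2a_1)\triangleleft b=a_1(a_2\triangleleft b)-a_2(a_1\triangleleft b)$; (2) $b\triangleright(a_1a_2)-a_1(b\triangleright a_2)=(b\triangleright a_1-a_1\triangleleft b)a_2$; (3) $b_1\triangleright(a\triangleleft b_2)-(b_1\triangleright a)\triangleleft b_2=a\triangleleft(b_1b_2)-(a\triangleleft b_1)\triangleleft b_2+a\chi(b_1,b_2)$; (4) $(b_1b_2-b_2b_1)\triangleright a=b_1\triangleright(b_2\triangleright a)-b_2\triangleright(b_1\triangleright a)-\chi(b_1,b_2)a+\chi(b_2,b_1)a$; (5) $\chi(b_1b_2,b_3)-\chi(b_1,b_2b_3)-\chi(b_2b_1,b_3)+\chi(b_2,b_1b_3)=b_1\triangleright\chi(b_2,b_3)-b_2\triangleright\chi(b_1,b_3)-\chi(b_1,b_2)\triangleleft b_3+\chi(b_2,b_1)\triangleleft b_3$. $Z^{2}_{nab}(B,A)$ is the set of these cocycles. For a non-abelian 2-cocycle, $A\rtimes_{(\triangleright,\triangleleft,\chi)}B$ denotes the vector space $A\oplus B$ with product $(a_1,b_1)(a_2,b_2)=(a_1a_2+b_1\triangleright a_2+a_1\triangleleft b_2+\chi(b_1,b_2),\,b_1b_2)$; it is asserted that $(\triangleright,\triangleleft,\chi)$ is a non-abelian 2-cocycle if and only if this product makes $A\oplus B$ a perm algebra. The extension $\mathcal{E}^{(\triangleright,\triangleleft,\chi)}$ is $0\to A\to A\rtimes_{(\triangleright,\triangleleft,\chi)}B\to B\to0$ with the canonical injection and projection. Non-abelian 2-cocycles $(\triangleright,\triangleleft,\chi)$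 and $(\triangleright',\triangleleft',\chi')$ are equivalent if there is a linear map $\lambda:B\to A$ such that for all $a\in A$, $b,b_1,b_2\in B$: $a\triangleleft b-a\triangleleft'b=a\lambda(b)$, $b\triangleright a-b\triangleright'a=\lambda(b)a$, and $\chi(b_1,b_2)-\chi'(b_1,b_2)=\lambda(b_1)\lambda(b_2)+b_1\triangleright'\lambda(b_2)+\lambda(b_1)\triangleleft'b_2-\lambda(b_1b_2)$. The non-abelian cohomology $H^{2}_{nab}(B,A)$ is the quotient of $Z^{2}_{nab}(B,A)$ by this equivalence relation.
   Formalization: Identities (1)–(5) do not imply that the product on A⊕B is perm (e.g. A=B=K with zero product, b▷a=ba, ◁=χ=0), so a non-abelian 2-cocycle is additionally required to make A⊕B a perm algebra, as the asserted criterion says. *)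

theory Defs
  imports Complex_Main "HOL-Library.Product_Plus"
begin

text \<open>
  An algebra over a field is given by its scalar multiplication and its product; the underlying
  abelian group is that of the type.  Characteristic zero is the sort \<open>field_char_0\<close> of the scalars.
\<close>

record ('k, 'v) alg =
  scal :: "'k \<Rightarrow> 'v \<Rightarrow> 'v"
  mul :: "'v \<Rightarrow> 'v \<Rightarrow> 'v"

definition bilinear_map ::
  "('k::field \<Rightarrow> 'u::ab_group_add \<Rightarrow> 'u) \<Rightarrow> ('k \<Rightarrow> 'v::ab_group_add \<Rightarrow> 'v) \<Rightarrow>
   ('k \<Rightarrow> 'w::ab_group_add \<Rightarrow> 'w) \<Rightarrow> ('u \<Rightarrow> 'v \<Rightarrow> 'w) \<Rightarrow> bool" where
  "bilinear_map s\<^sub>1 s\<^sub>2 s\<^sub>3 f \<longleftrightarrow>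
     (\<forall>x. Vector_Spaces.linear s\<^sub>2 s\<^sub>3 (f x)) \<and> (\<forall>y. Vector_Spaces.linear s\<^sub>1 s\<^sub>3 (\<lambda>x. f x y))"

definition perm_algebra :: "('k::field_char_0, 'v::ab_group_add) alg \<Rightarrow> bool" where
  "perm_algebra A \<longleftrightarrow>
     vector_space (scal A) \<and>
     bilinear_map (scal A) (scal A) (scal A) (mul A) \<and>
     (\<forall>x y z. mul A (mul A x y) z = mul A x (mul A y z) \<and>
              mul A x (mul A y z) = mul A x (mul A z y))"

definition perm_hom ::
  "('k::field_char_0, 'v::ab_group_add) alg \<Rightarrow> ('k, 'w::ab_group_add) alg \<Rightarrow> ('v \<Rightarrow> 'w) \<Rightarrow> bool" where
  "perm_hom A B f \<longleftrightarrow>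
     Vector_Spaces.linear (scal A) (scal B) f \<and> (\<forall>x y. f (mul A x y) = mul B (f x) (f y))"

subsection \<open>Non-abelian extensions\<close>

record ('k, 'a, 'b, 'e) extension =
  mid :: "('k, 'e) alg"
  inj_map :: "'a \<Rightarrow> 'e"
  proj_map :: "'e \<Rightarrow> 'b"

definition is_extension ::
  "('k::field_char_0, 'a::ab_group_add) alg \<Rightarrow> ('k, 'b::ab_group_add) alg \<Rightarrow>
   ('k, 'a, 'b, 'e::ab_group_add) extension \<Rightarrow> bool" where
  "is_extension A B X \<longleftrightarrow>
     perm_algebra (mid X) \<and>
     perm_hom A (mid X) (inj_map X) \<and> perm_hom (mid X) B (proj_map X) \<and>
     inj (inj_map X) \<and> range (inj_map X) = {e. proj_map X e = 0} \<and> surj (proj_map X)"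

text \<open>The middle terms of the two extensions may live on different types.\<close>

definition ext_equivalent ::
  "('k::field_char_0, 'a, 'b, 'e::ab_group_add) extension \<Rightarrow>
   ('k, 'a, 'b, 'f::ab_group_add) extension \<Rightarrow> bool" where
  "ext_equivalent X Y \<longleftrightarrow>
     (\<exists>\<phi>. perm_hom (mid X) (mid Y) \<phi> \<and>
          \<phi> \<circ> inj_map X = inj_map Y \<and> proj_map Y \<circ> \<phi> = proj_map X)"

definition extensions ::
  "('k::field_char_0, 'a::ab_group_add) alg \<Rightarrow> ('k, 'b::ab_group_add) alg \<Rightarrow>
   ('k, 'a, 'b, 'e::ab_group_add) extension set" where
  "extensions A B = {X. is_extension A B X}"

definition ext_rel ::
  "('k::field_char_0, 'a::ab_group_add) alg \<Rightarrow> ('k, 'b::ab_group_add) alg \<Rightarrow>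
   (('k, 'a, 'b, 'e::ab_group_add) extension \<times> ('k, 'a, 'b, 'e) extension) set" where
  "ext_rel A B = {(X, Y). X \<in> extensions A B \<and> Y \<in> extensions A B \<and> ext_equivalent X Y}"

text \<open>
  HOL has no set of all extensions with middle terms of arbitrary type, so the type \<open>'e\<close> of the
  middle term is a parameter of the set of equivalence classes.
\<close>

definition Ext ::
  "('k::field_char_0, 'a::ab_group_add) alg \<Rightarrow> ('k, 'b::ab_group_add) alg \<Rightarrow>
   ('k, 'a, 'b, 'e::ab_group_add) extension set set" where
  "Ext A B = extensions A B // ext_rel A B"

subsection \<open>Non-abelian 2-cocycles\<close>

record ('a, 'b) triple =
  lact :: "'b \<Rightarrow> 'a \<Rightarrow> 'a"
  ract :: "'a \<Rightarrow> 'b \<Rightarrow> 'a"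
  chi :: "'b \<Rightarrow> 'b \<Rightarrow> 'a"

definition bilinear_triple ::
  "('k::field_char_0, 'a::ab_group_add) alg \<Rightarrow> ('k, 'b::ab_group_add) alg \<Rightarrow>
   ('a, 'b) triple \<Rightarrow> bool" where
  "bilinear_triple A B t \<longleftrightarrow>
     bilinear_map (scal B) (scal A) (scal A) (lact t) \<and>
     bilinear_map (scal A) (scal B) (scal A) (ract t) \<and>
     bilinear_map (scal B) (scal B) (scal A) (chi t)"

definition cocycle_identities ::
  "('k::field_char_0, 'a::ab_group_add) alg \<Rightarrow> ('k, 'b::ab_group_add) alg \<Rightarrow>
   ('a, 'b) triple \<Rightarrow> bool" where
  "cocycle_identities A B t \<longleftrightarrow>
     (let mA = mul A; mB = mul B; l = lact t; r = ract t; c = chi t in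
      (\<forall>a\<^sub>1 a\<^sub>2 b. r (mA a\<^sub>1 a\<^sub>2) b - r (mA a\<^sub>2 a\<^sub>1) b = mA a\<^sub>1 (r a\<^sub>2 b) - mA a\<^sub>2 (r a\<^sub>1 b)) \<and>
      (\<forall>a\<^sub>1 a\<^sub>2 b. l b (mA a\<^sub>1 a\<^sub>2) - mA a\<^sub>1 (l b a\<^sub>2) = mA (l b a\<^sub>1 - r a\<^sub>1 b) a\<^sub>2) \<and>
      (\<forall>a b\<^sub>1 b\<^sub>2. l b\<^sub>1 (r a b\<^sub>2) - r (l b\<^sub>1 a) b\<^sub>2 =
                 r a (mB b\<^sub>1 b\<^sub>2) - r (r a b\<^sub>1) b\<^sub>2 + mA a (c b\<^sub>1 b\<^sub>2)) \<and>
      (\<forall>a b\<^sub>1 b\<^sub>2. l (mB b\<^sub>1 b\<^sub>2 - mB b\<^sub>2 b\<^sub>1) a =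
                 l b\<^sub>1 (l b\<^sub>2 a) - l b\<^sub>2 (l b\<^sub>1 a) - mA (c b\<^sub>1 b\<^sub>2) a + mA (c b\<^sub>2 b\<^sub>1) a) \<and>
      (\<forall>b\<^sub>1 b\<^sub>2 b\<^sub>3. c (mB b\<^sub>1 b\<^sub>2) b\<^sub>3 - c b\<^sub>1 (mB b\<^sub>2 b\<^sub>3) - c (mB b\<^sub>2 b\<^sub>1) b\<^sub>3 + c b\<^sub>2 (mB b\<^sub>1 b\<^sub>3) =
                 l b\<^sub>1 (c b\<^sub>2 b\<^sub>3) - l b\<^sub>2 (c b\<^sub>1 b\<^sub>3) - r (c b\<^sub>1 b\<^sub>2) b\<^sub>3 + r (c b\<^sub>2 b\<^sub>1) b\<^sub>3))"

definition semidirect ::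
  "('k::field_char_0, 'a::ab_group_add) alg \<Rightarrow> ('k, 'b::ab_group_add) alg \<Rightarrow>
   ('a, 'b) triple \<Rightarrow> ('k, 'a \<times> 'b) alg" where
  "semidirect A B t =
     \<lparr>scal = (\<lambda>k (a, b). (scal A k a, scal B k b)),
      mul = (\<lambda>(a\<^sub>1, b\<^sub>1) (a\<^sub>2, b\<^sub>2).
        (mul A a\<^sub>1 a\<^sub>2 + lact t b\<^sub>1 a\<^sub>2 + ract t a\<^sub>1 b\<^sub>2 + chi t b\<^sub>1 b\<^sub>2, mul B b\<^sub>1 b\<^sub>2))\<rparr>"

text \<open>
  The five identities in \<open>cocycle_identities\<close> are the components of the left-symmetric identity
  \<open>(x y) z - (y x) z = x (y z) - y (x z)\<close> of the product on \<open>A \<oplus> B\<close>.  The perm identities imply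
  them, but not conversely (lemma \<open>cocycle_identities_not_sufficient\<close> below).  A triple satisfying
  only these five identities therefore need not define an extension.  The criterion that a triple
  is a cocycle iff its product makes \<open>A \<oplus> B\<close> a perm algebra is hence part of the definition, next
  to the five identities; lemma \<open>nab_cocycle_iff\<close> recovers that criterion.
\<close>

definition nab_cocycle ::
  "('k::field_char_0, 'a::ab_group_add) alg \<Rightarrow> ('k, 'b::ab_group_add) alg \<Rightarrow>
   ('a, 'b) triple \<Rightarrow> bool" where
  "nab_cocycle A B t \<longleftrightarrow>
     bilinear_triple A B t \<and> cocycle_identities A B t \<and> perm_algebra (semidirect A B t)"

definition Z2_nab ::
  "('k::field_char_0, 'a::ab_group_add) alg \<Rightarrow> ('k, 'b::ab_group_add) alg \<Rightarrow>
   ('a, 'b) triple set" where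
  "Z2_nab A B = {t. nab_cocycle A B t}"

definition cocycle_equivalent ::
  "('k::field_char_0, 'a::ab_group_add) alg \<Rightarrow> ('k, 'b::ab_group_add) alg \<Rightarrow>
   ('a, 'b) triple \<Rightarrow> ('a, 'b) triple \<Rightarrow> bool" where
  "cocycle_equivalent A B t t' \<longleftrightarrow>
     (\<exists>h. Vector_Spaces.linear (scal B) (scal A) h \<and>
        (\<forall>a b. ract t a b - ract t' a b = mul A a (h b)) \<and>
        (\<forall>a b. lact t b a - lact t' b a = mul A (h b) a) \<and>
        (\<forall>b\<^sub>1 b\<^sub>2. chi t b\<^sub>1 b\<^sub>2 - chi t' b\<^sub>1 b\<^sub>2 =
           mul A (h b\<^sub>1) (h b\<^sub>2) + lact t' b\<^sub>1 (h b\<^sub>2) + ract t' (h b\<^sub>1) b\<^sub>2 - h (mul B b\<^sub>1 b\<^sub>2)))"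

definition cocycle_rel ::
  "('k::field_char_0, 'a::ab_group_add) alg \<Rightarrow> ('k, 'b::ab_group_add) alg \<Rightarrow>
   (('a, 'b) triple \<times> ('a, 'b) triple) set" where
  "cocycle_rel A B =
     {(t, t'). t \<in> Z2_nab A B \<and> t' \<in> Z2_nab A B \<and> cocycle_equivalent A B t t'}"

definition H2_nab ::
  "('k::field_char_0, 'a::ab_group_add) alg \<Rightarrow> ('k, 'b::ab_group_add) alg \<Rightarrow>
   ('a, 'b) triple set set" where
  "H2_nab A B = Z2_nab A B // cocycle_rel A B"

definition cocycle_ext ::
  "('k::field_char_0, 'a::ab_group_add) alg \<Rightarrow> ('k, 'b::ab_group_add) alg \<Rightarrow>
   ('a, 'b) triple \<Rightarrow> ('k, 'a, 'b, 'a \<times> 'b) extension" where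
  "cocycle_ext A B t = \<lparr>mid = semidirect A B t, inj_map = (\<lambda>a. (a, 0)), proj_map = snd\<rparr>"

subsection \<open>The five identities and the perm identities\<close>

lemma bilinear_mapD:
  assumes "bilinear_map s\<^sub>1 s\<^sub>2 s\<^sub>3 f"
  shows "f (x + x') y = f x y + f x' y" "f x (y + y') = f x y + f x y'"
    "f (x - x') y = f x y - f x' y" "f x (y - y') = f x y - f x y'"
    "f 0 y = 0" "f x 0 = 0"
proof -
  have r: "module_hom s\<^sub>2 s\<^sub>3 (f x)" for x
    using assms by (simp add: bilinear_map_def Vector_Spaces.linear_def)
  have l: "module_hom s\<^sub>1 s\<^sub>3 (\<lambda>x. f x y)" for y
    using assms by (simp add: bilinear_map_def Vector_Spaces.linear_def)
  show "f (x + x') y = f x y + f x' y" by (rule module_hom.add[OF l])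
  show "f x (y + y') = f x y + f x y'" by (rule module_hom.add[OF r])
  show "f (x - x') y = f x y - f x' y" by (rule module_hom.diff[OF l])
  show "f x (y - y') = f x y - f x y'" by (rule module_hom.diff[OF r])
  show "f 0 y = 0" by (rule module_hom.zero[OF l])
  show "f x 0 = 0" by (rule module_hom.zero[OF r])
qed

lemma perm_imp_cocycle_identities:
  fixes A :: "('k::field_char_0, 'a::ab_group_add) alg" and B :: "('k, 'b::ab_group_add) alg"
  assumes A: "perm_algebra A" and B: "perm_algebra B"
    and t: "bilinear_triple A B t" and P: "perm_algebra (semidirect A B t)"
  shows "cocycle_identities A B t"
proof -
  let ?m = "mul (semidirect A B t)"
  have assoc: "fst (?m (?m x y) z) = fst (?m x (?m y z))" for x y z
    using P unfolding perm_algebra_def by metis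
  have bA: "bilinear_map (scal A) (scal A) (scal A) (mul A)"
    and bB: "bilinear_map (scal B) (scal B) (scal B) (mul B)"
    using A B by (simp_all add: perm_algebra_def)
  have bl: "bilinear_map (scal B) (scal A) (scal A) (lact t)"
    and br: "bilinear_map (scal A) (scal B) (scal A) (ract t)"
    and bc: "bilinear_map (scal B) (scal B) (scal A) (chi t)"
    using t by (simp_all add: bilinear_triple_def)
  note bi = bilinear_mapD[OF bA] bilinear_mapD[OF bB] bilinear_mapD[OF bl]
    bilinear_mapD[OF br] bilinear_mapD[OF bc]
  have m: "?m (a\<^sub>1, b\<^sub>1) (a\<^sub>2, b\<^sub>2) =
      (mul A a\<^sub>1 a\<^sub>2 + lact t b\<^sub>1 a\<^sub>2 + ract t a\<^sub>1 b\<^sub>2 + chi t b\<^sub>1 b\<^sub>2, mul B b\<^sub>1 b\<^sub>2)" for a\<^sub>1 b\<^sub>1 a\<^sub>2 b\<^sub>2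
    by (simp add: semidirect_def)
  have AAB: "ract t (mul A a\<^sub>1 a\<^sub>2) b = mul A a\<^sub>1 (ract t a\<^sub>2 b)" for a\<^sub>1 a\<^sub>2 b
    using assoc[of "(a\<^sub>1, 0)" "(a\<^sub>2, 0)" "(0, b)"] by (simp add: m bi)
  have ABA: "mul A (ract t a\<^sub>1 b) a\<^sub>2 = mul A a\<^sub>1 (lact t b a\<^sub>2)" for a\<^sub>1 a\<^sub>2 b
    using assoc[of "(a\<^sub>1, 0)" "(0, b)" "(a\<^sub>2, 0)"] by (simp add: m bi)
  have BAA: "mul A (lact t b a\<^sub>1) a\<^sub>2 = lact t b (mul A a\<^sub>1 a\<^sub>2)" for a\<^sub>1 a\<^sub>2 b
    using assoc[of "(0, b)" "(a\<^sub>1, 0)" "(a\<^sub>2, 0)"] by (simp add: m bi)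
  have ABB: "ract t (ract t a b\<^sub>1) b\<^sub>2 = ract t a (mul B b\<^sub>1 b\<^sub>2) + mul A a (chi t b\<^sub>1 b\<^sub>2)" for a b\<^sub>1 b\<^sub>2
    using assoc[of "(a, 0)" "(0, b\<^sub>1)" "(0, b\<^sub>2)"] by (simp add: m bi algebra_simps)
  have BAB: "ract t (lact t b\<^sub>1 a) b\<^sub>2 = lact t b\<^sub>1 (ract t a b\<^sub>2)" for a b\<^sub>1 b\<^sub>2
    using assoc[of "(0, b\<^sub>1)" "(a, 0)" "(0, b\<^sub>2)"] by (simp add: m bi)
  have BBA: "lact t (mul B b\<^sub>1 b\<^sub>2) a = lact t b\<^sub>1 (lact t b\<^sub>2 a) - mul A (chi t b\<^sub>1 b\<^sub>2) a" for a b\<^sub>1 b\<^sub>2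
    using assoc[of "(0, b\<^sub>1)" "(0, b\<^sub>2)" "(a, 0)"] by (simp add: m bi algebra_simps)
  have BBB: "chi t (mul B b\<^sub>1 b\<^sub>2) b\<^sub>3 =
      lact t b\<^sub>1 (chi t b\<^sub>2 b\<^sub>3) + chi t b\<^sub>1 (mul B b\<^sub>2 b\<^sub>3) - ract t (chi t b\<^sub>1 b\<^sub>2) b\<^sub>3" for b\<^sub>1 b\<^sub>2 b\<^sub>3
    using assoc[of "(0, b\<^sub>1)" "(0, b\<^sub>2)" "(0, b\<^sub>3)"] by (simp add: m bi algebra_simps)
  show ?thesis
    unfolding cocycle_identities_def Let_def
    by (simp add: bi AAB ABA BAA ABB BAB BBA BBB)
qed

lemma nab_cocycle_iff:
  assumes "perm_algebra A" "perm_algebra B"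
  shows "nab_cocycle A B t \<longleftrightarrow> bilinear_triple A B t \<and> perm_algebra (semidirect A B t)"
  using perm_imp_cocycle_identities[OF assms] by (auto simp: nab_cocycle_def)

lemma cocycle_identities_not_sufficient:
  fixes A :: "('k::field_char_0, 'k) alg"
  defines "A \<equiv> \<lparr>scal = (*), mul = (\<lambda>_ _. 0)\<rparr>"
  defines "t \<equiv> \<lparr>lact = (*), ract = (\<lambda>_ _. 0), chi = (\<lambda>_ _. 0)\<rparr>"
  shows "perm_algebra A" "bilinear_triple A A t" "cocycle_identities A A t"
    "\<not> perm_algebra (semidirect A A t)"
proof -
  have vs: "vector_space ((*) :: 'k \<Rightarrow> 'k \<Rightarrow> 'k)"
    by unfold_locales (simp_all add: algebra_simps)
  have lin: "Vector_Spaces.linear (*) (*) f" if "f = (*) c \<or> f = (\<lambda>x. x * c)" for f :: "'k \<Rightarrow> 'k" and c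
    using that by unfold_locales (auto simp: algebra_simps)
  have lin0: "Vector_Spaces.linear (*) (*) (\<lambda>_::'k. 0::'k)"
    by unfold_locales (simp_all add: algebra_simps)
  show "perm_algebra A"
    by (simp add: perm_algebra_def bilinear_map_def A_def vs lin0)
  show "bilinear_triple A A t"
    by (auto simp: bilinear_triple_def bilinear_map_def A_def t_def lin0 intro!: lin)
  show "cocycle_identities A A t"
    by (simp add: cocycle_identities_def A_def t_def)
  show "\<not> perm_algebra (semidirect A A t)"
  proof
    assume "perm_algebra (semidirect A A t)"
    then have "mul (semidirect A A t) (mul (semidirect A A t) (0, 1) (0, 1)) (1, 0) =
        mul (semidirect A A t) (0, 1) (mul (semidirect A A t) (0, 1) (1, 0))"
      unfolding perm_algebra_def by blast
    then show False
      by (simp add: semidirect_def A_def t_def)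
  qed
qed

end

theory Submission
  imports Defs
begin

text \<open>
  Write \<open>E\<^sub>t\<close> for the extension \<open>A \<rightarrow> A \<oplus> B \<rightarrow> B\<close> attached to a cocycle \<open>t\<close>.  A linear map
  \<open>A \<oplus> B \<rightarrow> A \<oplus> B\<close> compatible with the injections of \<open>A\<close> and the projections to \<open>B\<close> has the form
  \<open>(a, b) \<mapsto> (a + h b, b)\<close> with \<open>h : B \<rightarrow> A\<close> linear, and comparing the products of \<open>(a, 0)\<close> and
  \<open>(0, b)\<close> shows that it is a morphism \<open>E\<^sub>t \<rightarrow> E\<^sub>t\<^sub>'\<close> exactly when \<open>h\<close> witnesses the equivalence of
  \<open>t\<close> and \<open>t'\<close>.  So \<open>t\<close> and \<open>t'\<close> are equivalent iff \<open>E\<^sub>t\<close> and \<open>E\<^sub>t\<^sub>'\<close> are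
  (\<open>cocycle_equivalent_iff\<close>).  Since a morphism between extensions is bijective (the short five
  lemma), equivalence of extensions is symmetric; hence both relations are equivalence relations,
  and \<open>[t] \<mapsto> [E\<^sub>t]\<close> is well defined and injective.

  For surjectivity, split the projection of an extension \<open>\<iota> : A \<rightarrow> E\<close>, \<open>\<pi> : E \<rightarrow> B\<close> by a linear
  section \<open>\<sigma>\<close>.  Then \<open>\<theta> (a, b) = \<iota> a + \<sigma> b\<close> is injective, and pulling the product of \<open>E\<close> back
  along \<open>\<theta>\<close> gives the product of \<open>A \<oplus> B\<close> for the triple \<open>t\<close> with \<open>\<iota> (b \<triangleright> a) = \<sigma> b \<iota> a\<close>,
  \<open>\<iota> (a \<triangleleft> b) = \<iota> a \<sigma> b\<close> and \<open>\<iota> (\<chi> (b, b')) = \<sigma> b \<sigma> b' - \<sigma> (b b')\<close>.  The perm identities of \<open>E\<close>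
  therefore pass to \<open>A \<oplus> B\<close>, so \<open>t\<close> is a cocycle, and \<open>\<theta>\<close> is an equivalence from \<open>E\<^sub>t\<close> to the
  given extension (\<open>extension_equivalent_cocycle_ext\<close>).
\<close>

section \<open>Bilinear maps and transport of structure\<close>

lemma bilinear_map_iff:
  "bilinear_map s\<^sub>1 s\<^sub>2 s\<^sub>3 f \<longleftrightarrow>
     vector_space s\<^sub>1 \<and> vector_space s\<^sub>2 \<and> vector_space s\<^sub>3 \<and>
     (\<forall>x x' y. f (x + x') y = f x y + f x' y) \<and> (\<forall>x y y'. f x (y + y') = f x y + f x y') \<and>
     (\<forall>c x y. f (s\<^sub>1 c x) y = s\<^sub>3 c (f x y)) \<and> (\<forall>c x y. f x (s\<^sub>2 c y) = s\<^sub>3 c (f x y))"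
  unfolding bilinear_map_def Vector_Spaces.linear_iff by auto

lemma linearD:
  assumes "Vector_Spaces.linear s\<^sub>1 s\<^sub>2 f"
  shows "f (x + y) = f x + f y" "f (x - y) = f x - f y" "f (s\<^sub>1 c x) = s\<^sub>2 c (f x)" "f 0 = 0"
proof -
  interpret Vector_Spaces.linear s\<^sub>1 s\<^sub>2 f by fact
  show "f (x + y) = f x + f y" "f (x - y) = f x - f y" "f (s\<^sub>1 c x) = s\<^sub>2 c (f x)" "f 0 = 0"
    by (simp_all add: add diff scale zero)
qed

lemma vector_spaceD:
  assumes "vector_space s"
  shows "s c 0 = 0" "s c (x + y) = s c x + s c y"
proof -
  interpret vector_space s by fact
  show "s c 0 = 0" "s c (x + y) = s c x + s c y" by (simp_all add: scale_right_distrib)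
qed

lemma bilinear_map_pullback:
  assumes j: "Vector_Spaces.linear s\<^sub>3 s i" "inj i"
    and f: "\<And>x y. i (f x y) = g x y"
    and g: "bilinear_map s\<^sub>1 s\<^sub>2 s g"
  shows "bilinear_map s\<^sub>1 s\<^sub>2 s\<^sub>3 f"
  using j g unfolding bilinear_map_iff Vector_Spaces.linear_iff
  by (auto intro!: injD[OF \<open>inj i\<close>] simp: f)

lemma bilinear_map_comp:
  assumes "Vector_Spaces.linear s\<^sub>1 t\<^sub>1 p" "Vector_Spaces.linear s\<^sub>2 t\<^sub>2 q" "bilinear_map t\<^sub>1 t\<^sub>2 s g"
  shows "bilinear_map s\<^sub>1 s\<^sub>2 s (\<lambda>x y. g (p x) (q y))"
  using assms unfolding bilinear_map_iff Vector_Spaces.linear_iff by auto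

lemma linear_comp_bilinear_map:
  assumes "Vector_Spaces.linear s t f" "bilinear_map s\<^sub>1 s\<^sub>2 s g"
  shows "bilinear_map s\<^sub>1 s\<^sub>2 t (\<lambda>x y. f (g x y))"
  using assms unfolding bilinear_map_iff Vector_Spaces.linear_iff by auto

lemma bilinear_map_diff:
  assumes "bilinear_map s\<^sub>1 s\<^sub>2 s f" "bilinear_map s\<^sub>1 s\<^sub>2 s g"
  shows "bilinear_map s\<^sub>1 s\<^sub>2 s (\<lambda>x y. f x y - g x y)"
proof -
  interpret vector_space s using assms(1) by (simp add: bilinear_map_iff)
  show ?thesis
    using assms unfolding bilinear_map_iff by (auto simp: scale_right_diff_distrib)
qed

lemma perm_algebra_bilinear:
  "perm_algebra A \<Longrightarrow> bilinear_map (scal A) (scal A) (scal A) (mul A)"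
  by (simp add: perm_algebra_def)

text \<open>
  No bilinearity or perm identity is required of \<open>F\<close>: an injective linear multiplicative map into
  a perm algebra supplies both.
\<close>

lemma perm_algebra_pullback:
  assumes "perm_algebra E" "vector_space (scal F)" "perm_hom F E \<theta>" "inj \<theta>"
  shows "perm_algebra F"
proof -
  have lin: "Vector_Spaces.linear (scal F) (scal E) \<theta>"
    and m: "\<And>x y. \<theta> (mul F x y) = mul E (\<theta> x) (\<theta> y)"
    using assms(3) by (auto simp: perm_hom_def)
  have "bilinear_map (scal F) (scal F) (scal F) (mul F)"
    using lin \<open>inj \<theta>\<close> m bilinear_map_comp[OF lin lin perm_algebra_bilinear[OF assms(1)]]
    by (rule bilinear_map_pullback)
  moreover have "mul F (mul F x y) z = mul F x (mul F y z)"
    "mul F x (mul F y z) = mul F x (mul F z y)" for x y z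
    using assms(1) by (auto intro!: injD[OF \<open>inj \<theta>\<close>] simp: m perm_algebra_def)
  ultimately show ?thesis
    using assms(2) unfolding perm_algebra_def by blast
qed

lemma vector_space_semidirect:
  assumes "vector_space (scal A)" "vector_space (scal B)"
  shows "vector_space (scal (semidirect A B t))"
proof -
  interpret a: vector_space "scal A" by fact
  interpret b: vector_space "scal B" by fact
  show ?thesis
    by unfold_locales
      (auto simp: semidirect_def a.scale_right_distrib b.scale_right_distrib
        a.scale_left_distrib b.scale_left_distrib)
qed

lemma mul_semidirect:
  "mul (semidirect A B t) (a\<^sub>1, b\<^sub>1) (a\<^sub>2, b\<^sub>2) =
     (mul A a\<^sub>1 a\<^sub>2 + lact t b\<^sub>1 a\<^sub>2 + ract t a\<^sub>1 b\<^sub>2 + chi t b\<^sub>1 b\<^sub>2, mul B b\<^sub>1 b\<^sub>2)"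
  by (simp add: semidirect_def)

lemma scal_semidirect: "scal (semidirect A B t) k (a, b) = (scal A k a, scal B k b)"
  by (simp add: semidirect_def)

section \<open>Equivalence of extensions\<close>

lemma ext_equivalent_refl:
  assumes "is_extension A B X"
  shows "ext_equivalent X X"
  unfolding ext_equivalent_def
  using assms
  by (intro exI[of _ id])
    (auto simp: is_extension_def perm_algebra_def perm_hom_def Vector_Spaces.linear_iff)

lemma ext_equivalent_trans:
  assumes "ext_equivalent X Y" "ext_equivalent Y Z"
  shows "ext_equivalent X Z"
proof -
  obtain f g where "perm_hom (mid X) (mid Y) f" "f \<circ> inj_map X = inj_map Y" "proj_map Y \<circ> f = proj_map X"
    and "perm_hom (mid Y) (mid Z) g" "g \<circ> inj_map Y = inj_map Z" "proj_map Z \<circ> g = proj_map Y"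
    using assms by (auto simp: ext_equivalent_def)
  then show ?thesis
    unfolding ext_equivalent_def
    by (intro exI[of _ "g \<circ> f"])
      (auto simp: perm_hom_def Vector_Spaces.linear_iff fun_eq_iff)
qed

text \<open>The short five lemma: a morphism of extensions is bijective, and its inverse is a morphism.\<close>

lemma ext_equivalent_sym:
  assumes X: "is_extension A B X" and Y: "is_extension A B Y" and "ext_equivalent X Y"
  shows "ext_equivalent Y X"
proof -
  obtain f where f: "perm_hom (mid X) (mid Y) f"
    and fi: "f \<circ> inj_map X = inj_map Y" and pf: "proj_map Y \<circ> f = proj_map X"
    using assms(3) by (auto simp: ext_equivalent_def)
  have lf: "Vector_Spaces.linear (scal (mid X)) (scal (mid Y)) f"
    using f by (simp add: perm_hom_def)
  have lp: "Vector_Spaces.linear (scal (mid Y)) (scal B) (proj_map Y)"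
    and li: "Vector_Spaces.linear (scal A) (scal (mid Y)) (inj_map Y)"
    and lX: "Vector_Spaces.linear (scal A) (scal (mid X)) (inj_map X)"
    using X Y by (simp_all add: is_extension_def perm_hom_def)
  have fi': "f (inj_map X a) = inj_map Y a" for a using fi by (metis comp_apply)
  have pf': "proj_map Y (f x) = proj_map X x" for x using pf by (metis comp_apply)
  have "x = 0" if "f x = 0" for x
  proof -
    have "proj_map X x = 0" using pf'[of x] that linearD(4)[OF lp] by simp
    then have "x \<in> range (inj_map X)" using X by (simp add: is_extension_def)
    then obtain a where a: "x = inj_map X a" by blast
    then have "inj_map Y a = inj_map Y 0" using that fi' linearD(4)[OF li] by simp
    then have "a = 0" using Y by (auto simp: is_extension_def dest: injD)
    then show ?thesis using a linearD(4)[OF lX] by simp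
  qed
  then have inj: "inj f"
    by (metis injI linearD(2)[OF lf] eq_iff_diff_eq_0)
  have "surj f"
    unfolding surj_def
  proof
    fix y
    obtain x where x: "proj_map Y y = proj_map X x"
      using X by (metis is_extension_def surjD)
    then have "proj_map Y (y - f x) = 0" by (simp add: linearD(2)[OF lp] pf')
    then have "y - f x \<in> range (inj_map Y)" using Y by (simp add: is_extension_def)
    then obtain a where "y - f x = inj_map Y a" by blast
    then have "y = f (x + inj_map X a)" by (simp add: linearD(1)[OF lf] fi' algebra_simps)
    then show "\<exists>x. y = f x" by blast
  qed
  define g where "g = inv f"
  have gf: "g (f x) = x" and fg: "f (g y) = y" for x y
    using inj \<open>surj f\<close> by (simp_all add: g_def surj_f_inv_f)
  have "perm_hom (mid Y) (mid X) g"
    using f unfolding perm_hom_def Vector_Spaces.linear_iff by (metis gf fg)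
  moreover have "g \<circ> inj_map Y = inj_map X" "proj_map X \<circ> g = proj_map Y"
    by (auto simp: fun_eq_iff gf fg simp flip: fi' pf')
  ultimately show ?thesis unfolding ext_equivalent_def by blast
qed

lemma equiv_ext_rel: "equiv (extensions A B) (ext_rel A B)"
proof (rule equivI)
  show "ext_rel A B \<subseteq> extensions A B \<times> extensions A B"
    by (auto simp: ext_rel_def)
  show "refl_on (extensions A B) (ext_rel A B)"
    by (auto simp: refl_on_def ext_rel_def extensions_def ext_equivalent_refl)
  show "sym (ext_rel A B)"
    by (auto simp: sym_def ext_rel_def extensions_def intro: ext_equivalent_sym)
  show "trans (ext_rel A B)"
    by (auto simp: trans_def ext_rel_def intro: ext_equivalent_trans)
qed

section \<open>Cocycles and their extensions\<close>

lemma is_extension_cocycle_ext: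
  assumes A: "perm_algebra A" and B: "perm_algebra B" and t: "nab_cocycle A B t"
  shows "is_extension A B (cocycle_ext A B t)"
proof -
  have b: "bilinear_map (scal B) (scal A) (scal A) (lact t)"
    "bilinear_map (scal A) (scal B) (scal A) (ract t)"
    "bilinear_map (scal B) (scal B) (scal A) (chi t)"
    and P: "perm_algebra (semidirect A B t)"
    using t by (auto simp: nab_cocycle_def bilinear_triple_def)
  have vs: "vector_space (scal A)" "vector_space (scal B)" "vector_space (scal (semidirect A B t))"
    using A B P by (auto simp: perm_algebra_def)
  have B0: "mul B 0 0 = 0"
    using bilinear_mapD(5)[OF perm_algebra_bilinear[OF B]] .
  have B1: "scal B c 0 = 0" for c
    using vector_spaceD(1)[OF vs(2)] .
  have "perm_hom A (semidirect A B t) (\<lambda>a. (a, 0))"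
    using vs
    by (simp add: perm_hom_def Vector_Spaces.linear_iff mul_semidirect scal_semidirect
        b[THEN bilinear_mapD(5)] b[THEN bilinear_mapD(6)] B0 B1)
  moreover have "perm_hom (semidirect A B t) B snd"
    using vs by (auto simp: perm_hom_def Vector_Spaces.linear_iff mul_semidirect scal_semidirect)
  ultimately show ?thesis
    using P by (auto simp: is_extension_def cocycle_ext_def inj_def)
qed

text \<open>
  The morphisms \<open>E\<^sub>t \<rightarrow> E\<^sub>t\<^sub>'\<close> are the maps \<open>(a, b) \<mapsto> (a + h b, b)\<close> with \<open>h\<close> a witness of the
  equivalence of \<open>t\<close> and \<open>t'\<close>.
\<close>

lemma cocycle_equivalent_iff:
  assumes A: "perm_algebra A" and B: "perm_algebra B"
    and t: "nab_cocycle A B t" and t': "nab_cocycle A B t'"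
  shows "cocycle_equivalent A B t t' \<longleftrightarrow> ext_equivalent (cocycle_ext A B t) (cocycle_ext A B t')"
proof -
  have vs: "vector_space (scal A)" "vector_space (scal B)"
    "vector_space (scal (semidirect A B t))" "vector_space (scal (semidirect A B t'))"
    using A B t t' by (auto simp: perm_algebra_def nab_cocycle_def)
  have b: "bilinear_map (scal B) (scal A) (scal A) (lact t)"
    "bilinear_map (scal A) (scal B) (scal A) (ract t)"
    "bilinear_map (scal B) (scal B) (scal A) (chi t)"
    "bilinear_map (scal B) (scal A) (scal A) (lact t')"
    "bilinear_map (scal A) (scal B) (scal A) (ract t')"
    "bilinear_map (scal B) (scal B) (scal A) (chi t')"
    "bilinear_map (scal A) (scal A) (scal A) (mul A)"
    "bilinear_map (scal B) (scal B) (scal B) (mul B)"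
    using t t' A B by (auto simp: nab_cocycle_def bilinear_triple_def perm_algebra_def)
  note bi = b[THEN bilinear_mapD(1)] b[THEN bilinear_mapD(2)]
    b[THEN bilinear_mapD(5)] b[THEN bilinear_mapD(6)]
  note zero = vector_spaceD(1)[OF vs(1)] vector_spaceD(1)[OF vs(2)]
  note defs = perm_hom_def Vector_Spaces.linear_iff mul_semidirect scal_semidirect
  show ?thesis
  proof
    assume "cocycle_equivalent A B t t'"
    then obtain h where h: "Vector_Spaces.linear (scal B) (scal A) h"
      and r: "\<And>a b. ract t a b = ract t' a b + mul A a (h b)"
      and l: "\<And>a b. lact t b a = lact t' b a + mul A (h b) a"
      and c: "\<And>b\<^sub>1 b\<^sub>2. chi t b\<^sub>1 b\<^sub>2 = chi t' b\<^sub>1 b\<^sub>2 + (mul A (h b\<^sub>1) (h b\<^sub>2) + lact t' b\<^sub>1 (h b\<^sub>2) +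
        ract t' (h b\<^sub>1) b\<^sub>2 - h (mul B b\<^sub>1 b\<^sub>2))"
      unfolding cocycle_equivalent_def by (metis diff_eq_eq add.commute)
    have "perm_hom (semidirect A B t) (semidirect A B t') (\<lambda>(a, b). (a + h b, b))"
      using vs by (auto simp: defs bi r l c linearD[OF h]
          vector_spaceD(2)[OF vs(1)] algebra_simps)
    then show "ext_equivalent (cocycle_ext A B t) (cocycle_ext A B t')"
      unfolding ext_equivalent_def cocycle_ext_def
      by (intro exI[of _ "\<lambda>(a, b). (a + h b, b)"]) (auto simp: fun_eq_iff linearD(4)[OF h])
  next
    assume "ext_equivalent (cocycle_ext A B t) (cocycle_ext A B t')"
    then obtain f where f: "perm_hom (semidirect A B t) (semidirect A B t') f"
      and fi: "\<And>a. f (a, 0) = (a, 0)" and pf: "\<And>x. snd (f x) = snd x"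
      unfolding ext_equivalent_def cocycle_ext_def by (auto simp: fun_eq_iff)
    define h where "h b = fst (f (0, b))" for b
    have lf: "Vector_Spaces.linear (scal (semidirect A B t)) (scal (semidirect A B t')) f"
      and mf: "\<And>x y. f (mul (semidirect A B t) x y) = mul (semidirect A B t') (f x) (f y)"
      using f by (auto simp: perm_hom_def)
    have f0: "f (0, b) = (h b, b)" for b
      using pf[of "(0, b)"] by (simp add: h_def prod_eq_iff)
    have fh: "f (a, b) = (a + h b, b)" for a b
      using linearD(1)[OF lf, of "(a, 0)" "(0, b)"] by (simp add: fi f0)
    have hlin: "Vector_Spaces.linear (scal B) (scal A) h"
      unfolding Vector_Spaces.linear_iff
    proof (intro conjI allI vs)
      show "h (x + y) = h x + h y" for x y
        using linearD(1)[OF lf, of "(0, x)" "(0, y)"] by (simp add: f0)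
      show "h (scal B c x) = scal A c (h x)" for c x
        using linearD(3)[OF lf, of c "(0, x)"] by (simp add: f0 scal_semidirect zero)
    qed
    have h0: "h 0 = 0" using linearD(4)[OF hlin] .
    have "ract t a b - ract t' a b = mul A a (h b)" for a b
      using mf[of "(a, 0)" "(0, b)"] by (simp add: fh mul_semidirect bi h0 algebra_simps)
    moreover have "lact t b a - lact t' b a = mul A (h b) a" for a b
      using mf[of "(0, b)" "(a, 0)"] by (simp add: fh mul_semidirect bi h0 algebra_simps)
    moreover have "chi t b\<^sub>1 b\<^sub>2 - chi t' b\<^sub>1 b\<^sub>2 =
        mul A (h b\<^sub>1) (h b\<^sub>2) + lact t' b\<^sub>1 (h b\<^sub>2) + ract t' (h b\<^sub>1) b\<^sub>2 - h (mul B b\<^sub>1 b\<^sub>2)" for b\<^sub>1 b\<^sub>2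
      using mf[of "(0, b\<^sub>1)" "(0, b\<^sub>2)"] by (simp add: fh mul_semidirect bi h0 algebra_simps)
    ultimately show "cocycle_equivalent A B t t'"
      unfolding cocycle_equivalent_def using hlin by blast
  qed
qed

lemma cocycle_rel_iff_ext_rel:
  assumes "perm_algebra A" "perm_algebra B" "t \<in> Z2_nab A B" "t' \<in> Z2_nab A B"
  shows "(t, t') \<in> cocycle_rel A B \<longleftrightarrow> (cocycle_ext A B t, cocycle_ext A B t') \<in> ext_rel A B"
  using assms(3,4) cocycle_equivalent_iff[OF assms(1,2), of t t']
    is_extension_cocycle_ext[OF assms(1,2), of t] is_extension_cocycle_ext[OF assms(1,2), of t']
  by (simp add: cocycle_rel_def ext_rel_def extensions_def Z2_nab_def)

text \<open>Every extension is, after the choice of a linear section, the extension of a cocycle.\<close>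

lemma extension_equivalent_cocycle_ext:
  assumes A: "perm_algebra A" and B: "perm_algebra B" and X: "is_extension A B X"
  obtains t where "nab_cocycle A B t" "ext_equivalent X (cocycle_ext A B t)"
proof -
  define E i p where "E = mid X" and "i = inj_map X" and "p = proj_map X"
  have E: "perm_algebra E" and hi: "perm_hom A E i" and hp: "perm_hom E B p"
    and inj: "inj i" and ker: "range i = {e. p e = 0}" and surj: "surj p"
    using X by (auto simp: is_extension_def E_def i_def p_def)
  have li: "Vector_Spaces.linear (scal A) (scal E) i"
    and mi: "\<And>x y. i (mul A x y) = mul E (i x) (i y)"
    and lp: "Vector_Spaces.linear (scal E) (scal B) p"
    and mp: "\<And>x y. p (mul E x y) = mul B (p x) (p y)"
    using hi hp by (auto simp: perm_hom_def)
  have vs: "vector_space (scal A)" "vector_space (scal B)" "vector_space (scal E)"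
    using A B E by (auto simp: perm_algebra_def)
  note bE = perm_algebra_bilinear[OF E] and bB = perm_algebra_bilinear[OF B]
  obtain s where ls: "Vector_Spaces.linear (scal B) (scal E) s" and "p \<circ> s = id"
    using vector_space_pair.linear_surjective_right_inverse[OF _ lp surj] vs
    by (auto simp: vector_space_pair_def)
  then have ps: "p (s b) = b" for b by (metis comp_apply id_apply)
  have pi: "p (i a) = 0" for a using ker by blast
  \<comment> \<open>Each argument of \<open>inv i\<close> is killed by \<open>p\<close>, hence lies in the range of \<open>i\<close>.\<close>
  define t where "t = \<lparr>lact = (\<lambda>b a. inv i (mul E (s b) (i a))),
    ract = (\<lambda>a b. inv i (mul E (i a) (s b))),
    chi = (\<lambda>b b'. inv i (mul E (s b) (s b') - s (mul B b b')))\<rparr>"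
  have i_inv: "i (inv i e) = e" if "p e = 0" for e
    using that by (intro f_inv_into_f) (simp add: ker)
  have il: "i (lact t b a) = mul E (s b) (i a)" for a b
    by (simp add: t_def i_inv mp pi bilinear_mapD[OF bB])
  have ir: "i (ract t a b) = mul E (i a) (s b)" for a b
    by (simp add: t_def i_inv mp pi bilinear_mapD[OF bB])
  have ic: "i (chi t b b') = mul E (s b) (s b') - s (mul B b b')" for b b'
    by (simp add: t_def i_inv mp ps linearD(2)[OF lp])
  have bt: "bilinear_triple A B t"
    unfolding bilinear_triple_def
    using bilinear_map_pullback[OF li inj il bilinear_map_comp[OF ls li bE]]
      bilinear_map_pullback[OF li inj ir bilinear_map_comp[OF li ls bE]]
      bilinear_map_pullback[OF li inj ic bilinear_map_diff[OF bilinear_map_comp[OF ls ls bE]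
          linear_comp_bilinear_map[OF ls bB]]]
    by blast
  define \<theta> where "\<theta> = (\<lambda>(a, b). i a + s b)"
  note linE = vector_spaceD(2)[OF vs(3)]
  have h\<theta>: "perm_hom (semidirect A B t) E \<theta>"
    using vs vector_space_semidirect[OF vs(1,2), of t]
    by (auto simp: perm_hom_def Vector_Spaces.linear_iff \<theta>_def mul_semidirect scal_semidirect
        linearD[OF li] linearD[OF ls] bilinear_mapD[OF bE] linE il ir ic mi)
  have "inj \<theta>"
  proof (rule injI, clarsimp simp: \<theta>_def)
    fix a b a' b'
    assume eq: "i a + s b = i a' + s b'"
    then have "p (i a + s b) = p (i a' + s b')" by simp
    then have "b = b'" by (simp add: linearD(1)[OF lp] pi ps)
    with eq inj show "a = a' \<and> b = b'" by (auto dest: injD)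
  qed
  then have "perm_algebra (semidirect A B t)"
    using perm_algebra_pullback[OF E vector_space_semidirect h\<theta>] vs by blast
  then have t: "nab_cocycle A B t"
    using nab_cocycle_iff[OF A B] bt by blast
  have "ext_equivalent (cocycle_ext A B t) X"
    unfolding ext_equivalent_def cocycle_ext_def
    using h\<theta> by (intro exI[of _ \<theta>])
      (auto simp: fun_eq_iff \<theta>_def E_def[symmetric] i_def[symmetric] p_def[symmetric]
        linearD(4)[OF ls] linearD(1)[OF lp] pi ps)
  then have "ext_equivalent X (cocycle_ext A B t)"
    using ext_equivalent_sym[OF is_extension_cocycle_ext[OF A B t] X] by blast
  then show thesis using t that by blast
qed

section \<open>The bijection on equivalence classes\<close>

lemma equiv_pullback:
  assumes "equiv T Q" "f ` S \<subseteq> T" "R \<subseteq> S \<times> S"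
    and "\<And>x y. x \<in> S \<Longrightarrow> y \<in> S \<Longrightarrow> (x, y) \<in> R \<longleftrightarrow> (f x, f y) \<in> Q"
  shows "equiv S R"
proof (rule equivI)
  have Q: "refl_on T Q" "sym Q" "trans Q" using assms(1) by (auto elim: equivE)
  show "R \<subseteq> S \<times> S" by fact
  show "refl_on S R" using assms Q(1) by (auto simp: refl_on_def)
  show "sym R" using assms(3,4) Q(2) unfolding sym_def by (metis SigmaE2 subsetD)
  show "trans R"
  proof (rule transI)
    fix x y z
    assume xy: "(x, y) \<in> R" and yz: "(y, z) \<in> R"
    then have S: "x \<in> S" "y \<in> S" "z \<in> S" using assms(3) by auto
    have "(f x, f y) \<in> Q" "(f y, f z) \<in> Q" using assms(4) S xy yz by auto
    then show "(x, z) \<in> R" using assms(4) S Q(3) by (auto dest: transD)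
  qed
qed

text \<open>
  The induced map on quotients is \<open>C \<mapsto> Q `` (f ` C)\<close>, which needs no choice of representatives.
\<close>

lemma quotient_bij_betw:
  assumes R: "equiv S R" and Q: "equiv T Q" and f: "f ` S \<subseteq> T"
    and iff: "\<And>x y. x \<in> S \<Longrightarrow> y \<in> S \<Longrightarrow> (x, y) \<in> R \<longleftrightarrow> (f x, f y) \<in> Q"
    and onto: "\<And>y. y \<in> T \<Longrightarrow> \<exists>x\<in>S. (y, f x) \<in> Q"
  shows "\<exists>\<Psi>. bij_betw \<Psi> (S // R) (T // Q) \<and> (\<forall>x\<in>S. \<Psi> (R `` {x}) = Q `` {f x})"
proof (intro exI conjI ballI)
  let ?\<Psi> = "\<lambda>C. Q `` (f ` C)"
  show \<Psi>: "?\<Psi> (R `` {x}) = Q `` {f x}" if "x \<in> S" for x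
  proof -
    have "Q `` {f y} = Q `` {f x}" if "y \<in> R `` {x}" for y
      using that \<open>x \<in> S\<close> R iff[of x y] equiv_class_eq[OF Q]
      by (metis Image_singleton_iff equiv_class_eq_iff)
    moreover have "x \<in> R `` {x}" using R \<open>x \<in> S\<close> by (rule equiv_class_self)
    ultimately show ?thesis by blast
  qed
  show "bij_betw ?\<Psi> (S // R) (T // Q)"
  proof (rule bij_betw_imageI)
    show "inj_on ?\<Psi> (S // R)"
    proof (rule inj_onI)
      fix C D
      assume "C \<in> S // R" "D \<in> S // R" and eq: "?\<Psi> C = ?\<Psi> D"
      then obtain x y where xy: "x \<in> S" "C = R `` {x}" "y \<in> S" "D = R `` {y}"
        by (auto elim!: quotientE)
      then have "Q `` {f x} = Q `` {f y}" using eq \<Psi> by metis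
      moreover have "f y \<in> T" using f xy by blast
      ultimately have "(x, y) \<in> R"
        using eq_equiv_class[OF _ Q] iff xy by metis
      then show "C = D" using equiv_class_eq[OF R] xy by blast
    qed
    show "?\<Psi> ` (S // R) = T // Q"
    proof
      show "?\<Psi> ` (S // R) \<subseteq> T // Q"
      proof (rule image_subsetI)
        fix C assume "C \<in> S // R"
        then obtain x where x: "x \<in> S" "C = R `` {x}" by (rule quotientE)
        then show "?\<Psi> C \<in> T // Q" using \<Psi> f by (auto intro!: quotientI)
      qed
      show "T // Q \<subseteq> ?\<Psi> ` (S // R)"
      proof
        fix D assume "D \<in> T // Q"
        then obtain y where y: "y \<in> T" "D = Q `` {y}" by (rule quotientE)
        then obtain x where x: "x \<in> S" "(y, f x) \<in> Q" using onto by blast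
        then have "D = ?\<Psi> (R `` {x})" using \<Psi> y equiv_class_eq[OF Q] by metis
        moreover have "R `` {x} \<in> S // R" using x(1) by (rule quotientI)
        ultimately show "D \<in> ?\<Psi> ` (S // R)" by (rule image_eqI)
      qed
    qed
  qed
qed

theorem theorem3p4:
  fixes A :: "('k::field_char_0, 'a::ab_group_add) alg"
    and B :: "('k, 'b::ab_group_add) alg"
  assumes "perm_algebra A" and "perm_algebra B"
  shows "equiv (Z2_nab A B) (cocycle_rel A B) \<and>
    equiv (extensions A B) (ext_rel A B :: (('k, 'a, 'b, 'a \<times> 'b) extension \<times> _) set) \<and>
    (\<exists>\<Psi> :: ('a, 'b) triple set \<Rightarrow> ('k, 'a, 'b, 'a \<times> 'b) extension set.
       bij_betw \<Psi> (H2_nab A B) (Ext A B) \<and>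
       (\<forall>t \<in> Z2_nab A B. \<Psi> (cocycle_rel A B `` {t}) = ext_rel A B `` {cocycle_ext A B t})) \<and>
    (\<forall>X :: ('k, 'a, 'b, 'e::ab_group_add) extension. is_extension A B X \<longrightarrow>
       (\<exists>!C. C \<in> H2_nab A B \<and> (\<forall>t \<in> C. ext_equivalent X (cocycle_ext A B t))))"
proof -
  note [simp] = assms
  let ?Q = "ext_rel A B :: (('k, 'a, 'b, 'a \<times> 'b) extension \<times> _) set"
  have ext: "is_extension A B (cocycle_ext A B t)" if "t \<in> Z2_nab A B" for t
    using that is_extension_cocycle_ext[of A B t] by (simp add: Z2_nab_def)
  then have sub: "cocycle_ext A B ` Z2_nab A B \<subseteq> extensions A B"
    by (auto simp: extensions_def)
  have rel: "cocycle_rel A B \<subseteq> Z2_nab A B \<times> Z2_nab A B"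
    by (auto simp: cocycle_rel_def)
  note iff = cocycle_rel_iff_ext_rel[OF assms]
  have R: "equiv (Z2_nab A B) (cocycle_rel A B)"
    using equiv_ext_rel sub rel iff by (rule equiv_pullback)
  have onto: "\<exists>t\<in>Z2_nab A B. (X, cocycle_ext A B t) \<in> ?Q" if "X \<in> extensions A B" for X
    using that ext extension_equivalent_cocycle_ext[OF assms, of X]
    by (fastforce simp: ext_rel_def extensions_def Z2_nab_def)
  have bij: "\<exists>\<Psi>. bij_betw \<Psi> (H2_nab A B) (Ext A B) \<and>
      (\<forall>t \<in> Z2_nab A B. \<Psi> (cocycle_rel A B `` {t}) = ?Q `` {cocycle_ext A B t})"
    unfolding H2_nab_def Ext_def using R equiv_ext_rel sub iff onto by (rule quotient_bij_betw)
  have "\<exists>!C. C \<in> H2_nab A B \<and> (\<forall>t \<in> C. ext_equivalent X (cocycle_ext A B t))"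
    if X: "is_extension A B X" for X :: "('k, 'a, 'b, 'e) extension"
  proof -
    obtain t where t: "t \<in> Z2_nab A B" and Xt: "ext_equivalent X (cocycle_ext A B t)"
      using extension_equivalent_cocycle_ext[OF assms X] by (auto simp: Z2_nab_def)
    show ?thesis
    proof (intro ex1I conjI ballI)
      show "cocycle_rel A B `` {t} \<in> H2_nab A B"
        unfolding H2_nab_def using t by (rule quotientI)
      show "ext_equivalent X (cocycle_ext A B t')" if "t' \<in> cocycle_rel A B `` {t}" for t'
        using that iff[of t t'] rel Xt by (auto simp: ext_rel_def intro: ext_equivalent_trans)
    next
      fix C
      assume C: "C \<in> H2_nab A B \<and> (\<forall>t\<in>C. ext_equivalent X (cocycle_ext A B t))"
      then obtain u where u: "u \<in> Z2_nab A B" "C = cocycle_rel A B `` {u}"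
        unfolding H2_nab_def by (auto elim: quotientE)
      then have "ext_equivalent X (cocycle_ext A B u)"
        using C equiv_class_self[OF R] by blast
      then have "ext_equivalent (cocycle_ext A B u) (cocycle_ext A B t)"
        using ext_equivalent_sym[OF X ext] u Xt ext_equivalent_trans by blast
      then have "(u, t) \<in> cocycle_rel A B"
        using iff[of u t] u t ext by (auto simp: ext_rel_def extensions_def)
      then show "C = cocycle_rel A B `` {t}"
        using u equiv_class_eq[OF R] by blast
    qed
  qed
  then show ?thesis using R equiv_ext_rel bij by blast
qed

end
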